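(* Let $G$ be a finite group and $p$ a prime with $\gcd(p-1,|G|)=1$. Suppose $|G'|=p^2$ and $|G'\cap Z(G)|=p$. Then: (a) $\Pr(G)=\frac{2p^2-1}{p^4}$ if $C_G(G')$ is abelian, and $\Pr(G)=\frac{1}{p^4}\left(\frac{p-1}{p^{2s-1}}+p^2+p-1\right)$ otherwise; (b) $|G/Z(G)|=p^3$ if $C_G(G')$ is abelian, and $|G/Z(G)|\in\{p^{2s+2},p^{2s+3}\}$ otherwise; where, when $C_G(G')$ is non-abelian, $s$ is the positive integer with $p^{2s}=|C_G(G'):Z(C_G(G'))|$. Moreover, writing $N=G'\cap Z(G)$ and $\bar G = G/N$, $\hat G = G/Z(G)$, we have $|\bar G : Z(\bar G)| = |\hat G : Z(\hat G)| = p^2$.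
   Context: $G$ is a finite group, $G'$ its commutator subgroup, $Z(G)$ its center, $C_G(G')$ the centralizer of $G'$ in $G$. The commutativity degree is $\Pr(G)=\frac{|\{(x,y)\in G\times G : xy=yx\}|}{|G|^2}$. *)

theory Defs
  imports "HOL-Algebra.Algebra" "HOL-Computational_Algebra.Primes"
begin

definition group_center :: "('a, 'b) monoid_scheme \<Rightarrow> 'a set" where
  "group_center G = {z \<in> carrier G. \<forall>x \<in> carrier G. z \<otimes>\<^bsub>G\<^esub> x = x \<otimes>\<^bsub>G\<^esub> z}"

definition centralizer :: "('a, 'b) monoid_scheme \<Rightarrow> 'a set \<Rightarrow> 'a set" where
  "centralizer G H = {x \<in> carrier G. \<forall>h \<in> H. x \<otimes>\<^bsub>G\<^esub> h = h \<otimes>\<^bsub>G\<^esub> x}"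

abbreviation commutator_subgroup :: "('a, 'b) monoid_scheme \<Rightarrow> 'a set" where
  "commutator_subgroup G \<equiv> derived G (carrier G)"

definition abelian_set :: "('a, 'b) monoid_scheme \<Rightarrow> 'a set \<Rightarrow> bool" where
  "abelian_set G H \<longleftrightarrow> (\<forall>x \<in> H. \<forall>y \<in> H. x \<otimes>\<^bsub>G\<^esub> y = y \<otimes>\<^bsub>G\<^esub> x)"

definition comm_degree :: "('a, 'b) monoid_scheme \<Rightarrow> real" where
  "comm_degree G =
     real (card {(x, y). x \<in> carrier G \<and> y \<in> carrier G \<and> x \<otimes>\<^bsub>G\<^esub> y = y \<otimes>\<^bsub>G\<^esub> x})
       / real (card (carrier G)) ^ 2"

end

theory Submission
  imports Defs "HOL-Number_Theory.Pocklington"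
begin

text \<open>
  Write \<open>K = G'\<close>, \<open>N = K \<inter> Z(G)\<close>, \<open>C = C\<^sub>G(K)\<close>, \<open>Y = Z(C)\<close> and \<open>[x, y] = x y x\<inverse> y\<inverse>\<close>.
  Conjugation acts on \<open>K / N\<close> through a group of order dividing both \<open>p - 1\<close> and \<open>|G|\<close>, hence
  trivially, so \<open>[G, K] = N\<close>. For \<open>k \<in> K - N\<close> the map \<open>[\<cdot>, k]\<close> is a homomorphism from \<open>G\<close> onto \<open>N\<close>
  with kernel \<open>C\<close>, so \<open>|G : C| = p\<close>; moreover \<open>[C, C] \<le> N\<close>.
  For \<open>y \<notin> C\<close> the map \<open>[\<cdot>, y]\<close> is a homomorphism from \<open>C\<close> onto \<open>K\<close>, under which the preimage of \<open>N\<close>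
  is the preimage \<open>M\<close> of both \<open>Z(G / N)\<close> and \<open>Z(G / Z(G))\<close>, and whose restriction to \<open>Y\<close> has image
  \<open>N\<close> or \<open>K\<close> and kernel \<open>Z(G)\<close>. Since the commutator induces a nondegenerate alternating form on
  \<open>C / Y\<close> with values in \<open>N\<close>, the index \<open>|C : Y|\<close> is an even power of \<open>p\<close>. The commuting pairs
  are counted by splitting \<open>G \<times> G\<close> according to membership in \<open>C\<close>.
\<close>

subsection \<open>Commutator maps and centralizers\<close>

context group
begin

text \<open>The bracket follows the convention of \<open>derived_set\<close>, so the generators of
  the derived subgroup are exactly its values.\<close>

definition commutator :: "'a \<Rightarrow> 'a \<Rightarrow> 'a" where
  "commutator x y = x \<otimes> y \<otimes> inv x \<otimes> inv y"

lemma inv_cancel_left [simp]: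
  assumes "x \<in> carrier G" "y \<in> carrier G"
  shows "inv x \<otimes> (x \<otimes> y) = y" "x \<otimes> (inv x \<otimes> y) = y"
  using assms by (simp_all add: m_assoc [symmetric])

lemma commutator_closed [simp]:
  assumes "x \<in> carrier G" "y \<in> carrier G"
  shows "commutator x y \<in> carrier G"
  using assms by (simp add: commutator_def)

lemma commutator_mult_swap:
  assumes "x \<in> carrier G" "y \<in> carrier G"
  shows "x \<otimes> y = commutator x y \<otimes> (y \<otimes> x)"
  using assms by (simp add: commutator_def m_assoc)

lemma commutator_eq_one_iff:
  assumes "x \<in> carrier G" "y \<in> carrier G"
  shows "commutator x y = \<one> \<longleftrightarrow> x \<otimes> y = y \<otimes> x"
proof
  assume "x \<otimes> y = y \<otimes> x"
  then show "commutator x y = \<one>"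
    using assms by (simp add: commutator_def m_assoc)
next
  assume "commutator x y = \<one>"
  then show "x \<otimes> y = y \<otimes> x"
    using commutator_mult_swap [OF assms] assms by simp
qed

lemma inv_commutator:
  assumes "x \<in> carrier G" "y \<in> carrier G"
  shows "inv (commutator x y) = commutator y x"
  using assms by (simp add: commutator_def inv_mult_group m_assoc)

lemma commutator_mult_left:
  assumes "g \<in> carrier G" "h \<in> carrier G" "y \<in> carrier G"
  shows "commutator (g \<otimes> h) y = g \<otimes> commutator h y \<otimes> inv g \<otimes> commutator g y"
  using assms by (simp add: commutator_def inv_mult_group m_assoc)

lemma commutator_conj:
  assumes "g \<in> carrier G" "x \<in> carrier G" "y \<in> carrier G"
  shows "g \<otimes> commutator x y \<otimes> inv g = commutator (g \<otimes> x \<otimes> inv g) (g \<otimes> y \<otimes> inv g)"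
  using assms by (simp add: commutator_def inv_mult_group m_assoc)

text \<open>The conjugation by \<open>g\<close> in \<open>commutator_mult_left\<close> disappears,
  so where such commuting holds the map \<open>commutator _ y\<close> is an
  antihomomorphism.\<close>

lemma commutator_mult_left_of_commute:
  assumes "g \<in> carrier G" "h \<in> carrier G" "y \<in> carrier G"
    and "g \<otimes> commutator h y = commutator h y \<otimes> g"
  shows "commutator (g \<otimes> h) y = commutator h y \<otimes> commutator g y"
  using assms by (simp add: commutator_mult_left m_assoc)

text \<open>By \<open>commutator_mult_left\<close> the two values differ by a conjugate of
  \<open>commutator h y\<close>, which is trivial exactly when \<open>commutator h y\<close>
  is.\<close>

lemma commutator_eq_iff:
  assumes "g \<in> carrier G" "h \<in> carrier G" "y \<in> carrier G"
  shows "commutator (g \<otimes> h) y = commutator g y \<longleftrightarrow> h \<otimes> y = y \<otimes> h"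
proof -
  have "commutator (g \<otimes> h) y = commutator g y \<longleftrightarrow> g \<otimes> commutator h y \<otimes> inv g = \<one>"
    using assms by (simp add: commutator_mult_left)
  also have "\<dots> \<longleftrightarrow> commutator h y = \<one>"
    using assms inv_solve_right' [of \<one> "g \<otimes> commutator h y" g] by auto
  finally show ?thesis
    using assms by (simp add: commutator_eq_one_iff)
qed

text \<open>The fibres of the map \<open>g \<mapsto> commutator g y\<close> are left cosets of the centralizer of \<open>y\<close>.\<close>

lemma card_commutator_image:
  assumes fin: "finite (carrier G)" and S: "subgroup S G" and y: "y \<in> carrier G"
  shows "card S = card ((\<lambda>g. commutator g y) ` S) * card {g \<in> S. g \<otimes> y = y \<otimes> g}"
proof -
  interpret S: subgroup S G by fact
  let ?f = "\<lambda>g. commutator g y"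
  have finS: "finite S" using fin S.subset finite_subset by blast
  have "card {g \<in> S. ?f g = v} = card {g \<in> S. g \<otimes> y = y \<otimes> g}" if v: "v \<in> ?f ` S" for v
  proof -
    obtain g where g: "g \<in> S" "v = ?f g" using v by auto
    have "{x \<in> S. ?f x = v} = (\<lambda>h. g \<otimes> h) ` {h \<in> S. h \<otimes> y = y \<otimes> h}"
    proof (intro equalityI subsetI)
      fix x assume x: "x \<in> {x \<in> S. ?f x = v}"
      have eq: "g \<otimes> (inv g \<otimes> x) = x" using x g by simp
      have "?f (g \<otimes> (inv g \<otimes> x)) = ?f g" using x g eq by simp
      then have "(inv g \<otimes> x) \<otimes> y = y \<otimes> (inv g \<otimes> x)"
        using commutator_eq_iff [of g "inv g \<otimes> x" y] x g y by simp
      then show "x \<in> (\<lambda>h. g \<otimes> h) ` {h \<in> S. h \<otimes> y = y \<otimes> h}"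
        using x g eq by (intro image_eqI [of _ _ "inv g \<otimes> x"]) auto
    next
      fix x assume "x \<in> (\<lambda>h. g \<otimes> h) ` {h \<in> S. h \<otimes> y = y \<otimes> h}"
      then show "x \<in> {x \<in> S. ?f x = v}" using g y commutator_eq_iff by auto
    qed
    moreover have "inj_on (\<lambda>h. g \<otimes> h) {h \<in> S. h \<otimes> y = y \<otimes> h}"
      using g by (auto intro!: inj_onI)
    ultimately show ?thesis by (simp add: card_image)
  qed
  then show ?thesis
    using sum.image_gen [OF finS, of "\<lambda>_. 1::nat" ?f] by simp
qed

text \<open>The hypothesis \<open>comm\<close> makes \<open>commutator _ y\<close> an
  antihomomorphism on \<open>S\<close>, and the image of a subgroup under such a map is a
  subgroup.\<close>

lemma subgroup_commutator_image:
  assumes S: "subgroup S G" and y: "y \<in> carrier G"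
    and comm: "\<And>g h. g \<in> S \<Longrightarrow> h \<in> S \<Longrightarrow> g \<otimes> commutator h y = commutator h y \<otimes> g"
  shows "subgroup ((\<lambda>g. commutator g y) ` S) G"
proof -
  interpret S: subgroup S G by fact
  have mult: "commutator h y \<otimes> commutator g y = commutator (g \<otimes> h) y" if "g \<in> S" "h \<in> S" for g h
    using that y comm by (simp add: commutator_mult_left_of_commute)
  show ?thesis
  proof (rule subgroupI)
    show "(\<lambda>g. commutator g y) ` S \<subseteq> carrier G" using y by auto
    show "(\<lambda>g. commutator g y) ` S \<noteq> {}" using S.one_closed by blast
  next
    fix a assume "a \<in> (\<lambda>g. commutator g y) ` S"
    then obtain g where g: "g \<in> S" "a = commutator g y" by auto
    have "commutator (inv g) y \<otimes> a = \<one>"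
      using mult [of g "inv g"] g y commutator_eq_one_iff [of \<one> y] by simp
    then have "inv a = commutator (inv g) y"
      using g y by (intro inv_equality) auto
    then show "inv a \<in> (\<lambda>g. commutator g y) ` S" using g by auto
  next
    fix a b assume "a \<in> (\<lambda>g. commutator g y) ` S" "b \<in> (\<lambda>g. commutator g y) ` S"
    then show "a \<otimes> b \<in> (\<lambda>g. commutator g y) ` S"
      using mult by (auto intro!: image_eqI)
  qed
qed

section \<open>Centralizers as subgroups\<close>

lemma subgroup_commuting:
  assumes S: "subgroup S G" and y: "y \<in> carrier G"
  shows "subgroup {g \<in> S. g \<otimes> y = y \<otimes> g} G"
proof -
  interpret S: subgroup S G by fact
  show ?thesis
  proof (rule subgroupI)
    show "{g \<in> S. g \<otimes> y = y \<otimes> g} \<subseteq> carrier G" by auto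
    have "\<one> \<in> {g \<in> S. g \<otimes> y = y \<otimes> g}" using y by simp
    then show "{g \<in> S. g \<otimes> y = y \<otimes> g} \<noteq> {}" by blast
  next
    fix a assume "a \<in> {g \<in> S. g \<otimes> y = y \<otimes> g}"
    then have a: "a \<in> S" and ay: "a \<otimes> y = y \<otimes> a" by auto
    have "inv a \<otimes> y = inv a \<otimes> (y \<otimes> a) \<otimes> inv a" using a y by (simp add: m_assoc)
    also have "\<dots> = inv a \<otimes> (a \<otimes> y) \<otimes> inv a" by (simp only: ay)
    also have "\<dots> = y \<otimes> inv a" using a y by simp
    finally show "inv a \<in> {g \<in> S. g \<otimes> y = y \<otimes> g}" using a by simp
  next
    fix a b assume "a \<in> {g \<in> S. g \<otimes> y = y \<otimes> g}" "b \<in> {g \<in> S. g \<otimes> y = y \<otimes> g}"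
    then have ab: "a \<in> S" "b \<in> S" and ay: "a \<otimes> y = y \<otimes> a" and bY: "b \<otimes> y = y \<otimes> b" by auto
    have "a \<otimes> b \<otimes> y = a \<otimes> (b \<otimes> y)" using ab y by (simp add: m_assoc)
    also have "\<dots> = a \<otimes> y \<otimes> b" unfolding bY using ab y by (simp add: m_assoc)
    also have "\<dots> = y \<otimes> (a \<otimes> b)" unfolding ay using ab y by (simp add: m_assoc)
    finally show "a \<otimes> b \<in> {g \<in> S. g \<otimes> y = y \<otimes> g}" using ab by simp
  qed
qed

lemma subgroup_commuting_set:
  assumes S: "subgroup S G" and H: "H \<subseteq> carrier G"
  shows "subgroup {g \<in> S. \<forall>y\<in>H. g \<otimes> y = y \<otimes> g} G"
proof -
  \<comment> \<open>Inserting \<open>S\<close> keeps the family nonempty, so that the intersection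
    is right for empty \<open>H\<close> too.\<close>
  have "subgroup (\<Inter> (insert S ((\<lambda>y. {g \<in> S. g \<otimes> y = y \<otimes> g}) ` H))) G"
    using S H subgroup_commuting by (intro subgroups_Inter) auto
  moreover have "\<Inter> (insert S ((\<lambda>y. {g \<in> S. g \<otimes> y = y \<otimes> g}) ` H)) = {g \<in> S. \<forall>y\<in>H. g \<otimes> y = y \<otimes> g}"
    by auto
  ultimately show ?thesis by simp
qed

lemma subgroup_centralizer: "H \<subseteq> carrier G \<Longrightarrow> subgroup (centralizer G H) G"
  using subgroup_commuting_set [OF subgroup_self] by (simp add: centralizer_def)

lemma subgroup_group_center: "subgroup (group_center G) G"
  using subgroup_commuting_set [OF subgroup_self, of "carrier G"] by (simp add: group_center_def)

section \<open>Lagrange arguments for prime order and prime index\<close>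

lemma card_subgroup_dvd:
  assumes "subgroup H G" "subgroup S G" "H \<subseteq> S"
  shows "card H dvd card S"
proof -
  interpret S: group "G\<lparr>carrier := S\<rparr>" using assms(2) by (rule subgroup_imp_group)
  show ?thesis
    using S.lagrange [OF subgroup_incl [OF assms]] by (simp add: order_def) (metis dvd_triv_right)
qed

text \<open>This turns nontriviality of a commutator map into values \<open>N\<close> into
  surjectivity onto \<open>N\<close>.\<close>

lemma subgroup_of_prime_order:
  assumes "subgroup T G" "subgroup N G" "T \<subseteq> N" "Factorial_Ring.prime (card N)" "T \<noteq> {\<one>}"
  shows "T = N"
proof -
  have fin: "finite N" using assms(4) card_ge_0_finite prime_gt_0_nat by blast
  have one: "\<one> \<in> T" using assms(1) by (rule subgroup.one_closed)
  have "card T dvd card N" using card_subgroup_dvd assms by blast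
  moreover have "card T \<noteq> 1" using one assms(5) by (auto simp: card_1_singleton_iff)
  ultimately have "card T = card N" using assms(4) by (auto simp: prime_nat_iff)
  then show ?thesis using fin assms(3) by (simp add: card_subset_eq)
qed

text \<open>The index of \<open>H\<close> in \<open>T\<close> divides \<open>p\<close> by Lagrange
  and is not 1. It serves both for \<open>N\<close> in \<open>K\<close> and for \<open>C\<close> in
  \<open>G\<close>.\<close>

lemma subgroup_of_prime_index:
  assumes "subgroup H G" "subgroup T G" "subgroup S G" "H \<subseteq> T" "T \<subseteq> S" "T \<noteq> H"
    and "finite S" "card S = p * card H" "Factorial_Ring.prime p"
  shows "T = S"
proof -
  have fin: "finite T" "finite H" using assms(4,5,7) finite_subset order_trans by metis+
  obtain m where m: "card T = card H * m" using card_subgroup_dvd assms(1,2,4) by (metis dvdE)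
  have H0: "card H > 0" using fin(2) subgroup.one_closed [OF assms(1)] card_gt_0_iff by blast
  have "card T dvd card S" using card_subgroup_dvd assms by blast
  then have "m dvd p" using m assms(8) H0 by (simp add: mult.commute)
  moreover have "m \<noteq> 1" using m card_subset_eq [OF fin(1) assms(4)] assms(6) by auto
  ultimately have "m = p" using assms(9) by (auto simp: prime_nat_iff)
  then show ?thesis using card_subset_eq [OF assms(7,5)] m assms(8) by (simp add: mult.commute)
qed

section \<open>The index of the center when all commutators lie in a central subgroup of prime
  order\<close>

text \<open>Two successive kernels: \<open>commutator _ a\<close> on \<open>S\<close> and
  \<open>commutator _ b\<close> on the centralizer of \<open>a\<close> in \<open>S\<close> both have
  image \<open>N\<close>, being nontrivial at \<open>b\<close> and at \<open>a\<close> respectively.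
  Each step divides the order by \<open>card N\<close>.\<close>

lemma card_commuting_pair:
  assumes fin: "finite (carrier G)" and S: "subgroup S G" and N: "subgroup N G"
    and p: "Factorial_Ring.prime (card N)"
    and comm: "\<And>x y. x \<in> S \<Longrightarrow> y \<in> S \<Longrightarrow> commutator x y \<in> N"
    and cent: "\<And>x n. x \<in> S \<Longrightarrow> n \<in> N \<Longrightarrow> x \<otimes> n = n \<otimes> x"
    and ab: "a \<in> S" "b \<in> S" "a \<otimes> b \<noteq> b \<otimes> a"
  shows "card S = card N ^ 2 * card {g \<in> S. g \<otimes> a = a \<otimes> g \<and> g \<otimes> b = b \<otimes> g}"
proof -
  interpret S: subgroup S G by fact
  have image: "(\<lambda>g. commutator g y) ` T = N"
    if T: "subgroup T G" "T \<subseteq> S" and y: "y \<in> S" and x: "x \<in> T" "x \<otimes> y \<noteq> y \<otimes> x" for T x y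
  proof (rule subgroup_of_prime_order [OF _ N _ p])
    show "subgroup ((\<lambda>g. commutator g y) ` T) G"
    proof (rule subgroup_commutator_image [OF T(1)])
      show "y \<in> carrier G" using y by simp
      show "g \<otimes> commutator h y = commutator h y \<otimes> g" if "g \<in> T" "h \<in> T" for g h
        using that T(2) y by (intro cent comm) auto
    qed
    show "(\<lambda>g. commutator g y) ` T \<subseteq> N" using T y comm by blast
    show "(\<lambda>g. commutator g y) ` T \<noteq> {\<one>}"
      using x y T commutator_eq_one_iff [of x y] by (metis S.mem_carrier imageI singletonD subsetD)
  qed
  let ?A = "{g \<in> S. g \<otimes> a = a \<otimes> g}"
  have A: "subgroup ?A G" using S ab by (intro subgroup_commuting) auto
  have "card S = card N * card ?A"
    using card_commutator_image [OF fin S, of a] image [OF S _ ab(1,2)] ab by auto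
  moreover have "card ?A = card N * card {g \<in> ?A. g \<otimes> b = b \<otimes> g}"
    using card_commutator_image [OF fin A, of b] image [OF A _ ab(2), of a] ab by auto
  moreover have "{g \<in> ?A. g \<otimes> b = b \<otimes> g} = {g \<in> S. g \<otimes> a = a \<otimes> g \<and> g \<otimes> b = b \<otimes> g}" by auto
  ultimately show ?thesis by (simp add: power2_eq_square)
qed

text \<open>For non-commuting \<open>a\<close>, \<open>b\<close>, counting shows that an element centralizing
  \<open>C(a) \<inter> C(b)\<close>, \<open>a\<close> and \<open>b\<close> is central, so passing to \<open>C(a) \<inter> C(b)\<close>
  divides the order by \<open>p\<^sup>2\<close> and keeps the center: one splits off a hyperbolic plane.\<close>

lemma card_central_quotient_even_power:
  assumes fin: "finite (carrier G)" and S: "subgroup S G" and N: "subgroup N G"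
    and p: "Factorial_Ring.prime (card N)"
    and comm: "\<And>x y. x \<in> S \<Longrightarrow> y \<in> S \<Longrightarrow> commutator x y \<in> N"
    and cent: "\<And>x n. x \<in> S \<Longrightarrow> n \<in> N \<Longrightarrow> x \<otimes> n = n \<otimes> x"
  shows "\<exists>s. card S = card N ^ (2 * s) * card {z \<in> S. \<forall>x\<in>S. z \<otimes> x = x \<otimes> z}"
  using S comm cent
proof (induction "card S" arbitrary: S rule: less_induct)
  case (less S)
  interpret S: subgroup S G by fact
  show ?case
  proof (cases "\<forall>a\<in>S. \<forall>b\<in>S. a \<otimes> b = b \<otimes> a")
    case True
    then have "{z \<in> S. \<forall>x\<in>S. z \<otimes> x = x \<otimes> z} = S" by auto
    then show ?thesis by (intro exI [of _ 0]) simp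
  next
    case False
    then obtain a b where ab: "a \<in> S" "b \<in> S" "a \<otimes> b \<noteq> b \<otimes> a" by auto
    define D where "D = {g \<in> S. g \<otimes> a = a \<otimes> g \<and> g \<otimes> b = b \<otimes> g}"
    have finS: "finite S" using fin S.subset finite_subset by blast
    have "D = {g \<in> S. \<forall>y\<in>{a, b}. g \<otimes> y = y \<otimes> g}" by (auto simp: D_def)
    then have D: "subgroup D G" using subgroup_commuting_set [OF less.prems(1), of "{a, b}"] ab by simp
    have DS: "D \<subseteq> S" by (auto simp: D_def)
    have cS: "card S = card N ^ 2 * card D"
      unfolding D_def by (rule card_commuting_pair [OF fin less.prems(1) N p less.prems(2,3) ab]) auto
    have "D \<noteq> S" using ab by (auto simp: D_def)
    then have "card D < card S" using DS finS by (simp add: psubset_card_mono psubset_eq)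
    then obtain s where s: "card D = card N ^ (2 * s) * card {z \<in> D. \<forall>x\<in>D. z \<otimes> x = x \<otimes> z}"
      using less.hyps [OF _ D] less.prems(2,3) DS by (meson subsetD)
    have "{z \<in> D. \<forall>x\<in>D. z \<otimes> x = x \<otimes> z} = {z \<in> S. \<forall>x\<in>S. z \<otimes> x = x \<otimes> z}" (is "?L = ?R")
    proof
      show "?R \<subseteq> ?L" using ab by (auto simp: D_def)
      show "?L \<subseteq> ?R"
      proof
        fix d assume d: "d \<in> ?L"
        \<comment> \<open>The centralizer \<open>E\<close> of \<open>d\<close> in \<open>S\<close>
          contains \<open>a\<close>, \<open>b\<close> and all of \<open>D\<close>, so counting in
          \<open>E\<close> with the same pair gives \<open>card E = card S\<close>.\<close>
        define E where "E = {g \<in> S. g \<otimes> d = d \<otimes> g}"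
        have dS: "d \<in> S" using d DS by auto
        have E: "subgroup E G" unfolding E_def using less.prems(1) dS by (intro subgroup_commuting) auto
        have abE: "a \<in> E" "b \<in> E" using d ab by (auto simp: E_def D_def)
        have ES: "E \<subseteq> S" by (auto simp: E_def)
        have "card E = card N ^ 2 * card {g \<in> E. g \<otimes> a = a \<otimes> g \<and> g \<otimes> b = b \<otimes> g}"
          using ES by (intro card_commuting_pair [OF fin E N p _ _ abE ab(3)] less.prems(2,3)) auto
        moreover have "{g \<in> E. g \<otimes> a = a \<otimes> g \<and> g \<otimes> b = b \<otimes> g} = D"
          using d unfolding E_def D_def by (blast intro: sym)
        ultimately have "E = S" using cS ES finS by (simp add: card_subset_eq)
        then show "d \<in> ?R" using dS unfolding E_def by (blast intro: sym)
      qed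
    qed
    then have "card S = card N ^ (2 * Suc s) * card ?R"
      using cS s by (simp add: power_add power2_eq_square)
    then show ?thesis by blast
  qed
qed

lemma conj_nat_pow:
  assumes "g \<in> carrier G" "k \<in> carrier G"
  shows "g \<otimes> k [^] (e::nat) \<otimes> inv g = (g \<otimes> k \<otimes> inv g) [^] e"
proof (induction e)
  case (Suc e)
  have "g \<otimes> k [^] Suc e \<otimes> inv g = (g \<otimes> k [^] e \<otimes> inv g) \<otimes> (g \<otimes> k \<otimes> inv g)"
    using assms by (simp add: m_assoc)
  then show ?case using Suc by simp
qed (use assms in simp)

subsection \<open>Quotients and their centers\<close>

lemma card_carrier_Mod:
  assumes "subgroup H G"
  shows "card (carrier (G Mod H)) * card H = card (carrier G)"
  using lagrange [OF assms] by (simp add: FactGroup_def order_def)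

lemma central_subgroup_normal:
  assumes H: "subgroup H G" "H \<subseteq> group_center G"
  shows "H \<lhd> G"
proof -
  have "x \<otimes> h \<otimes> inv x \<in> H" if x: "x \<in> carrier G" and h: "h \<in> H" for x h
  proof -
    have "h \<in> carrier G" "x \<otimes> h = h \<otimes> x" using H(2) h x unfolding group_center_def by auto
    then show ?thesis using x h by (simp add: m_assoc)
  qed
  then show ?thesis using H(1) by (simp add: normal_inv_iff)
qed

lemma rcoset_eq_iff:
  assumes H: "subgroup H G" and "a \<in> carrier G" "b \<in> carrier G"
  shows "H #> a = H #> b \<longleftrightarrow> a \<otimes> inv b \<in> H"
proof -
  have "a \<otimes> inv b \<in> H \<longleftrightarrow> a \<in> H #> b"
    using subgroup.rcos_module [OF H group_axioms assms(3,2)] by simp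
  also have "\<dots> \<longleftrightarrow> H #> a = H #> b"
    using repr_independence [OF _ assms(3) H] rcos_self [OF assms(2) H] by metis
  finally show ?thesis by simp
qed

text \<open>The cosets of \<open>g\<close> and \<open>x\<close> commute iff the quotient of
  \<open>g \<otimes> x\<close> by \<open>x \<otimes> g\<close>, which is
  \<open>commutator g x\<close>, lies in \<open>H\<close>.\<close>

lemma center_Mod:
  assumes H: "H \<lhd> G"
  shows "group_center (G Mod H) = (\<lambda>g. H #> g) ` {g \<in> carrier G. \<forall>x\<in>carrier G. commutator g x \<in> H}"
proof -
  interpret H: normal H G by fact
  have sub: "subgroup H G" by (rule H.subgroup_axioms)
  have *: "(H #> g) <#> (H #> x) = (H #> x) <#> (H #> g) \<longleftrightarrow> commutator g x \<in> H"
    if "g \<in> carrier G" "x \<in> carrier G" for g x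
    using that rcoset_eq_iff [OF sub, of "g \<otimes> x" "x \<otimes> g"]
    by (simp add: H.rcos_sum inv_mult_group commutator_def m_assoc)
  have carr: "carrier (G Mod H) = (\<lambda>g. H #> g) ` carrier G"
    by (auto simp: FactGroup_def RCOSETS_def)
  have mult: "x \<otimes>\<^bsub>G Mod H\<^esub> y = x <#> y" for x y
    by (simp add: FactGroup_def)
  show ?thesis
    unfolding group_center_def carr mult using * by blast
qed

text \<open>The center of \<open>G / H\<close> is \<open>M / H\<close> by \<open>center_Mod\<close>,
  so the double quotient has the order of \<open>G / M\<close>; Lagrange is applied to
  \<open>H\<close> in \<open>M\<close>, to \<open>H\<close> in \<open>G\<close> and to the center in
  \<open>G / H\<close>.\<close>

lemma card_Mod_center_Mod:
  assumes H: "H \<lhd> G"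
    and M: "subgroup M G" "M = {g \<in> carrier G. \<forall>x\<in>carrier G. commutator g x \<in> H}"
  shows "card (carrier ((G Mod H) Mod group_center (G Mod H))) * card M = card (carrier G)"
proof -
  interpret H: normal H G by fact
  have sub: "subgroup H G" by (rule H.subgroup_axioms)
  interpret Q: group "G Mod H" by (rule H.factorgroup_is_group)
  interpret MG: group "G\<lparr>carrier := M\<rparr>" using M(1) by (rule subgroup_imp_group)
  have "H \<subseteq> M"
  proof
    fix h assume h: "h \<in> H"
    have "commutator h x \<in> H" if "x \<in> carrier G" for x
      using that h H.inv_op_closed2 [of x "inv h"] by (simp add: commutator_def m_assoc)
    then show "h \<in> M" using h M(2) by auto
  qed
  then have HM: "subgroup H (G\<lparr>carrier := M\<rparr>)" using subgroup_incl [OF sub M(1)] by simp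
  have center: "group_center (G Mod H) = carrier (G\<lparr>carrier := M\<rparr> Mod H)"
    unfolding center_Mod [OF H] M(2) [symmetric]
    by (auto simp: FactGroup_def RCOSETS_def r_coset_def)
  have "card (group_center (G Mod H)) * card H = card M"
    unfolding center using MG.card_carrier_Mod [OF HM] by simp
  moreover have "card (carrier ((G Mod H) Mod group_center (G Mod H))) * card (group_center (G Mod H))
      = card (carrier (G Mod H))"
    using Q.lagrange [OF Q.subgroup_group_center] by (simp add: FactGroup_def order_def)
  ultimately show ?thesis
    using card_carrier_Mod [OF sub] by (metis mult.assoc)
qed

end

subsection \<open>Groups with derived subgroup of order \<open>p\<^sup>2\<close>\<close>

locale derived_subgroup_order_p2 = group G for G (structure) +
  fixes p :: nat
  assumes fin: "finite (carrier G)" and prime: "Factorial_Ring.prime p"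
    and coprime_order: "gcd (p - 1) (order G) = 1"
    and card_derived: "card (commutator_subgroup G) = p ^ 2"
    and card_derived_center: "card (commutator_subgroup G \<inter> group_center G) = p"
begin

definition "K = commutator_subgroup G"
definition "N = K \<inter> group_center G"
definition "C = centralizer G K"
definition "Y = {z \<in> C. \<forall>x\<in>C. z \<otimes> x = x \<otimes> z}"

lemma p_gt_1: "p > 1"
  using prime prime_gt_1_nat by blast

lemma card_K: "card K = p ^ 2" and card_N: "card N = p"
  using card_derived card_derived_center by (simp_all add: K_def N_def)

lemma prime_card_N: "Factorial_Ring.prime (card N)"
  using prime card_N by simp

lemma subgroup_K: "subgroup K G"
  unfolding K_def by (rule derived_is_subgroup) simp

lemma subgroup_N: "subgroup N G"
  unfolding N_def using subgroup_K subgroup_group_center by (rule subgroups_Inter_pair)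

lemma K_carrier: "K \<subseteq> carrier G"
  using subgroup_K by (rule subgroup.subset)

lemma subgroup_C: "subgroup C G"
  unfolding C_def using K_carrier by (rule subgroup_centralizer)

lemma subgroup_Y: "subgroup Y G"
  unfolding Y_def using subgroup_C subgroup.subset [OF subgroup_C] by (rule subgroup_commuting_set)

sublocale K: subgroup K G by (rule subgroup_K)
sublocale N: subgroup N G by (rule subgroup_N)
sublocale C: subgroup C G by (rule subgroup_C)
sublocale Y: subgroup Y G by (rule subgroup_Y)

lemma N_subset_K: "N \<subseteq> K"
  by (auto simp: N_def)

lemma N_central: "n \<in> N \<Longrightarrow> x \<in> carrier G \<Longrightarrow> n \<otimes> x = x \<otimes> n"
  unfolding N_def group_center_def by blast

lemma mem_N_iff: "k \<in> K \<Longrightarrow> k \<in> N \<longleftrightarrow> (\<forall>x\<in>carrier G. k \<otimes> x = x \<otimes> k)"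
  using K_carrier unfolding N_def group_center_def by blast

lemma finite_subgroup: "subgroup H G \<Longrightarrow> finite H"
  using fin subgroup.subset finite_subset by blast

lemma commutator_mem_K:
  assumes "x \<in> carrier G" "y \<in> carrier G"
  shows "commutator x y \<in> K"
  unfolding K_def derived_def commutator_def
  using assms by (intro generate.incl) blast

text \<open>Otherwise the generators of \<open>K\<close>, hence \<open>K\<close> itself, would lie
  in \<open>N\<close>, although \<open>p ^ 2 > p\<close>.\<close>

lemma ex_commutator_notin_N: "\<exists>x\<in>carrier G. \<exists>y\<in>carrier G. commutator x y \<notin> N"
proof (rule ccontr)
  assume "\<not> ?thesis"
  then have "derived_set G (carrier G) \<subseteq> N"
    by (auto simp: commutator_def)
  then have "K \<subseteq> N"
    unfolding K_def derived_def using subgroup_N by (rule generate_subgroup_incl)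
  then have "card K \<le> card N" using finite_subgroup [OF subgroup_N] by (rule card_mono [rotated])
  then show False using p_gt_1 by (simp add: card_K card_N power2_eq_square)
qed

section \<open>The quotient \<open>K / N\<close> of order \<open>p\<close> and the action of
  \<open>G\<close> on it\<close>

lemma card_K_N: "card K = p * card N"
  by (simp add: card_K card_N power2_eq_square)

lemma subgroup_between_N_K:
  assumes "subgroup T G" "N \<subseteq> T" "T \<subseteq> K" "T \<noteq> N"
  shows "T = K"
  using subgroup_of_prime_index [OF subgroup_N assms(1) subgroup_K assms(2-4) finite_subgroup [OF subgroup_K] card_K_N prime] .

text \<open>As \<open>K / N\<close> has prime order, \<open>k\<close> generates it. The set
  \<open>T\<close> is the preimage of the cyclic group generated by the coset of \<open>k\<close>;
  it is a subgroup because \<open>N\<close> is central.\<close>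

lemma K_decomposition:
  assumes k: "k \<in> K" "k \<notin> N" and x: "x \<in> K"
  shows "\<exists>n\<in>N. \<exists>i::int. x = n \<otimes> k [^] i"
proof -
  define T where "T = {n \<otimes> k [^] i | n (i::int). n \<in> N}"
  have kc: "k \<in> carrier G" using k by simp
  have memT: "n \<otimes> k [^] i \<in> T" if "n \<in> N" for n and i :: int using that T_def by blast
  have kK: "k [^] (i::int) \<in> K" for i using subgroup_int_pow_closed [OF subgroup_K k(1)] .
  have "subgroup T G"
  proof (rule subgroupI)
    show "T \<subseteq> carrier G" using kc by (auto simp: T_def)
    show "T \<noteq> {}" using memT [OF N.one_closed] by blast
  next
    fix a assume "a \<in> T"
    then obtain n i where a: "a = n \<otimes> k [^] (i::int)" "n \<in> N" by (auto simp: T_def)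
    have "inv a = inv (k [^] i \<otimes> n)" using a N_central [of n "k [^] i"] kc by simp
    also have "\<dots> = inv n \<otimes> k [^] (- i)" using a kc by (simp add: inv_mult_group int_pow_neg)
    finally show "inv a \<in> T" using a memT by simp
  next
    fix a b assume "a \<in> T" "b \<in> T"
    then obtain n i m j where a: "a = n \<otimes> k [^] (i::int)" "n \<in> N" and b: "b = m \<otimes> k [^] (j::int)" "m \<in> N"
      unfolding T_def by blast
    have "a \<otimes> b = n \<otimes> (k [^] i \<otimes> m) \<otimes> k [^] j" using a b kc by (simp add: m_assoc)
    also have "\<dots> = n \<otimes> (m \<otimes> k [^] i) \<otimes> k [^] j" using N_central [of m "k [^] i"] b kc by simp
    also have "\<dots> = (n \<otimes> m) \<otimes> k [^] (i + j)" using a b kc by (simp add: m_assoc int_pow_mult)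
    finally show "a \<otimes> b \<in> T" using a b memT by simp
  qed
  moreover have "N \<subseteq> T"
  proof
    fix n assume "n \<in> N"
    then show "n \<in> T" using memT [of n 0] by simp
  qed
  moreover have "T \<subseteq> K" using N_subset_K kK by (auto simp: T_def)
  moreover have "k \<in> T" using memT [OF N.one_closed, of 1] kc by simp
  ultimately have "T = K" using k by (intro subgroup_between_N_K) auto
  then show ?thesis using x by (auto simp: T_def)
qed

text \<open>If \<open>p\<close> did not divide \<open>i\<close>, then \<open>i\<close> would be
  invertible modulo \<open>p ^ 2\<close>, the order of \<open>K\<close>, and \<open>k\<close> would
  be a power of \<open>k [^] i\<close>, hence in \<open>N\<close>.\<close>

lemma pow_mem_N_imp_dvd:
  assumes k: "k \<in> K" "k \<notin> N" and i: "k [^] (i::int) \<in> N"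
  shows "int p dvd i"
proof (rule ccontr)
  assume "\<not> int p dvd i"
  moreover have "Factorial_Ring.prime (int p)" using prime by simp
  ultimately have "coprime (int p) i" by (intro prime_imp_coprime)
  then have "coprime i (int p ^ 2)" by (simp add: coprime_commute)
  then obtain u v where uv: "u * i + v * int p ^ 2 = 1"
    by (metis bezout_int coprime_iff_gcd_eq_1)
  have kc: "k \<in> carrier G" using k by simp
  interpret KG: group "G\<lparr>carrier := K\<rparr>" by (rule subgroup_imp_group [OF subgroup_K])
  have "k [^]\<^bsub>G\<lparr>carrier := K\<rparr>\<^esub> order (G\<lparr>carrier := K\<rparr>) = \<one>"
    using KG.pow_order_eq_1 [of k] k by simp
  then have one: "k [^] (p ^ 2) = \<one>"
    by (simp add: order_def card_K nat_pow_def)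
  have "i * u + int (p ^ 2) * v = 1" using uv by (simp add: mult.commute)
  then have "k = k [^] (i * u + int (p ^ 2) * v)" using kc by simp
  also have "\<dots> = (k [^] i) [^] u \<otimes> (k [^] int (p ^ 2)) [^] v"
    by (simp only: int_pow_mult [OF kc] int_pow_pow [OF kc])
  also have "\<dots> = (k [^] i) [^] u"
    using one kc int_pow_int [of G k "p ^ 2"] by simp
  also have "\<dots> \<in> N" using subgroup_int_pow_closed [OF subgroup_N i] .
  finally show False using k by simp
qed

text \<open>If not, \<open>k [^] p\<close> would itself generate \<open>K\<close> modulo
  \<open>N\<close>; expressing \<open>k\<close> through it puts some
  \<open>k [^] (1 - p * i)\<close> in \<open>N\<close>, and then \<open>p\<close> divides 1.\<close>

lemma pow_p_mem_N:
  assumes k: "k \<in> K" "k \<notin> N"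
  shows "k [^] int p \<in> N"
proof (rule ccontr)
  assume "k [^] int p \<notin> N"
  moreover have kc: "k \<in> carrier G" using k by simp
  moreover have "k [^] int p \<in> K" using subgroup_int_pow_closed [OF subgroup_K k(1)] .
  ultimately obtain n i where n: "n \<in> N" "k = n \<otimes> (k [^] int p) [^] (i::int)"
    using K_decomposition k by blast
  then have "k \<otimes> inv (k [^] (int p * i)) = n"
    using inv_solve_right [of n k "k [^] (int p * i)"] kc by (simp add: int_pow_pow)
  then have "k [^] (1 - int p * i) = n"
    using kc by (simp only: int_pow_diff int_pow_1)
  then have "int p dvd 1 - int p * i" using pow_mem_N_imp_dvd [OF k] n by simp
  then have "int p dvd (1 - int p * i) + int p * i" by (intro dvd_add) auto
  then show False using p_gt_1 by simp
qed

lemma pow_mem_N_iff: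
  assumes k: "k \<in> K" "k \<notin> N"
  shows "k [^] (i::int) \<in> N \<longleftrightarrow> int p dvd i"
proof
  assume "int p dvd i"
  then obtain c where c: "i = int p * c" by blast
  have "k [^] i = (k [^] int p) [^] c" using c k by (simp add: int_pow_pow)
  then show "k [^] i \<in> N" using subgroup_int_pow_closed [OF subgroup_N pow_p_mem_N [OF k]] by simp
qed (rule pow_mem_N_imp_dvd [OF k])

text \<open>Conjugation by \<open>g\<close> acts on the quotient \<open>K / N\<close> of order \<open>p\<close> as some power
  map \<open>a\<close>; as \<open>a\<close> has order dividing both \<open>order G\<close> and \<open>p - 1\<close>, it is trivial.\<close>

lemma commutator_mem_N:
  assumes g: "g \<in> carrier G" and kK: "k \<in> K"
  shows "commutator g k \<in> N"
proof (cases "k \<in> N")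
  case True
  then have "commutator g k = \<one>"
    using g N_central [of k g] by (simp add: commutator_eq_one_iff)
  then show ?thesis by simp
next
  case False
  have kc: "k \<in> carrier G" using kK by simp
  have "g \<otimes> k \<otimes> inv g = commutator g k \<otimes> k" using g kc by (simp add: commutator_def m_assoc)
  also have "\<dots> \<in> K" using commutator_mem_K g kc kK by simp
  finally obtain n0 i where n0: "n0 \<in> N" "g \<otimes> k \<otimes> inv g = n0 \<otimes> k [^] (i::int)"
    using K_decomposition [OF kK False] by blast
  \<comment> \<open>Reducing the exponent modulo \<open>p\<close> makes it a natural number, to
    which congruences on \<open>nat\<close> apply. The power of \<open>k\<close> split off lies in
    \<open>N\<close> and is absorbed into \<open>n1\<close>.\<close>
  define a where "a = nat (i mod int p)"
  define n1 where "n1 = n0 \<otimes> k [^] (int p * (i div int p))"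
  have n1: "n1 \<in> N" using n0 pow_mem_N_iff [OF kK False] by (simp add: n1_def)
  have "k [^] i = k [^] (int p * (i div int p)) \<otimes> k [^] (i mod int p)"
    by (simp only: int_pow_mult [OF kc, symmetric] mult_div_mod_eq)
  moreover have "i mod int p = int a" using p_gt_1 by (simp add: a_def)
  ultimately have conj: "g \<otimes> k \<otimes> inv g = n1 \<otimes> k [^] a"
    using n0 kc by (simp add: n1_def m_assoc int_pow_int)
  \<comment> \<open>If \<open>g\<close> acts modulo \<open>N\<close> as the power \<open>a\<close>,
    then \<open>g [^] m\<close> acts as the power \<open>a ^ m\<close>. At
    \<open>m = order G\<close> the action is trivial.\<close>
  have "\<exists>n\<in>N. g [^] m \<otimes> k \<otimes> inv (g [^] m) = n \<otimes> k [^] (a ^ m)" for m :: nat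
  proof (induction m)
    case 0
    show ?case using kc by (intro bexI [of _ \<one>]) simp_all
  next
    case (Suc m)
    then obtain n where n: "n \<in> N" "g [^] m \<otimes> k \<otimes> inv (g [^] m) = n \<otimes> k [^] (a ^ m)" by blast
    have "g [^] Suc m = g \<otimes> g [^] m" using g by (rule nat_pow_Suc2)
    then have "g [^] Suc m \<otimes> k \<otimes> inv (g [^] Suc m) = g \<otimes> (g [^] m \<otimes> k \<otimes> inv (g [^] m)) \<otimes> inv g"
      using g kc by (simp add: m_assoc inv_mult_group)
    also have "\<dots> = (g \<otimes> n) \<otimes> k [^] (a ^ m) \<otimes> inv g" using n g kc by (simp add: m_assoc)
    also have "\<dots> = n \<otimes> (g \<otimes> k [^] (a ^ m) \<otimes> inv g)"
      using N_central [OF n(1) g, symmetric] n g kc by (simp add: m_assoc)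
    also have "\<dots> = n \<otimes> (n1 \<otimes> k [^] a) [^] (a ^ m)"
      using conj g kc by (simp add: conj_nat_pow)
    also have "\<dots> = n \<otimes> (n1 [^] (a ^ m) \<otimes> k [^] (a ^ Suc m))"
      using pow_mult_distrib [OF N_central [OF n1, of "k [^] a"], of "a ^ m"] n1 kc by (simp add: nat_pow_pow)
    finally have "g [^] Suc m \<otimes> k \<otimes> inv (g [^] Suc m) = (n \<otimes> n1 [^] (a ^ m)) \<otimes> k [^] (a ^ Suc m)"
      using n n1 kc by (simp add: m_assoc)
    moreover have "n \<otimes> n1 [^] (a ^ m) \<in> N"
      using n(1) subgroup_int_pow_closed [OF subgroup_N n1, of "int (a ^ m)"]
      unfolding int_pow_int by (rule N.m_closed)
    ultimately show ?case by blast
  qed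
  from this [of "order G"] obtain n where n: "n \<in> N"
    and "g [^] order G \<otimes> k \<otimes> inv (g [^] order G) = n \<otimes> k [^] (a ^ order G)" by blast
  then have nk: "k = n \<otimes> k [^] (a ^ order G)" using kc by (simp add: pow_order_eq_1 [OF g])
  have "k [^] int (a ^ order G) \<otimes> inv k = inv n"
  proof -
    define x where "x = k [^] int (a ^ order G)"
    have x: "x \<in> carrier G" using kc by (simp add: x_def)
    have "k = n \<otimes> x" using nk unfolding x_def int_pow_int .
    then have "x \<otimes> inv k = x \<otimes> inv x \<otimes> inv n"
      using n x by (simp add: inv_mult_group m_assoc)
    then show ?thesis using n x by (simp add: x_def)
  qed
  then have "k [^] (int (a ^ order G) - 1) \<in> N"
    using n kc by (simp only: int_pow_diff int_pow_1) simp
  then have "int p dvd int (a ^ order G) - int 1" using pow_mem_N_iff [OF kK False] by simp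
  then have ord1: "[a ^ order G = 1] (mod p)"
    using cong_iff_dvd_diff [of "int (a ^ order G)" "int 1" "int p"] cong_int_iff by blast
  \<comment> \<open>With a positive exponent, \<open>a\<close> divides \<open>a ^ order G\<close>,
    which is 1 modulo \<open>p\<close>; so \<open>p\<close> does not divide \<open>a\<close> and
    Fermat applies.\<close>
  have "order G > 0" using fin order_gt_0_iff_finite by blast
  then have "\<not> p dvd a"
    using cong_dvd_iff [OF ord1] dvd_power [of "order G" a] p_gt_1 dvd_trans [of p a "a ^ order G"] by auto
  then have "[a ^ (p - 1) = 1] (mod p)" using prime by (intro fermat_theorem)
  then have "Pocklington.ord p a dvd gcd (p - 1) (order G)" using ord1 unfolding ord_divides by (rule gcd_greatest)
  then have "[a ^ 1 = 1] (mod p)" unfolding ord_divides coprime_order .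
  then have "[int a = int 1] (mod int p)" unfolding power_one_right cong_int_iff .
  then have "int p dvd int a - 1" unfolding cong_iff_dvd_diff of_nat_1 .
  then have "k [^] (int a - 1) \<in> N" using pow_mem_N_iff [OF kK False] by blast
  then have "k [^] a \<otimes> inv k \<in> N" using kc by (simp only: int_pow_diff int_pow_1 int_pow_int)
  with n1 have "n1 \<otimes> (k [^] a \<otimes> inv k) \<in> N" by (rule N.m_closed)
  moreover have "commutator g k = n1 \<otimes> (k [^] a \<otimes> inv k)"
    unfolding commutator_def conj using n1 kc by (simp add: m_assoc)
  ultimately show ?thesis by simp
qed

section \<open>The centralizer \<open>C\<close> of \<open>K\<close>, its index and its
  commutators\<close>

lemma ex_K_notin_N: "\<exists>k\<in>K. k \<notin> N"
  using ex_commutator_notin_N commutator_mem_K by blast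

lemma C_commutes: "c \<in> C \<Longrightarrow> k \<in> K \<Longrightarrow> c \<otimes> k = k \<otimes> c"
  unfolding C_def centralizer_def by blast

text \<open>The elements of \<open>K\<close> commuting with \<open>g\<close> form a subgroup
  containing \<open>N\<close> and \<open>k\<close>. Thus \<open>C\<close> is the centralizer of any
  single \<open>k\<close> outside \<open>N\<close>.\<close>

lemma commuting_with_K:
  assumes k: "k \<in> K" "k \<notin> N" and g: "g \<in> carrier G" "g \<otimes> k = k \<otimes> g" and x: "x \<in> K"
  shows "g \<otimes> x = x \<otimes> g"
proof -
  let ?T = "{x \<in> K. x \<otimes> g = g \<otimes> x}"
  have "subgroup ?T G" using subgroup_K g(1) by (rule subgroup_commuting)
  moreover have "N \<subseteq> ?T" using N_subset_K N_central g(1) by blast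
  moreover have "k \<in> ?T" using k g(2) by simp
  ultimately have "?T = K" using k by (intro subgroup_between_N_K) auto
  then have "x \<in> ?T" using x by simp
  then show ?thesis by simp
qed

text \<open>An \<open>x\<close> outside \<open>N\<close> commutes with itself, so
  \<open>commuting_with_K\<close> applies with \<open>x\<close> as both \<open>g\<close> and
  \<open>k\<close>.\<close>

lemma K_commute:
  assumes x: "x \<in> K" and y: "y \<in> K"
  shows "x \<otimes> y = y \<otimes> x"
proof (cases "x \<in> N")
  case True
  then show ?thesis using y by (intro N_central) auto
next
  case False
  then show ?thesis using commuting_with_K [OF x False _ _ y] x by simp
qed

lemma K_subset_Y: "K \<subseteq> Y"
proof
  fix k assume k: "k \<in> K"
  then have "k \<in> C" using K_commute unfolding C_def centralizer_def by simp
  then show "k \<in> Y" using C_commutes [OF _ k] unfolding Y_def by simp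
qed

lemma Y_subset_C: "Y \<subseteq> C"
  by (auto simp: Y_def)

lemma commutator_image_carrier:
  assumes k: "k \<in> K" "k \<notin> N"
  shows "(\<lambda>g. commutator g k) ` carrier G = N"
proof (rule subgroup_of_prime_order [OF _ subgroup_N _ prime_card_N])
  show "subgroup ((\<lambda>g. commutator g k) ` carrier G) G"
    using k by (intro subgroup_commutator_image [OF subgroup_self] N_central [symmetric] commutator_mem_N) auto
  show "(\<lambda>g. commutator g k) ` carrier G \<subseteq> N" using k commutator_mem_N by auto
  obtain x where x: "x \<in> carrier G" "k \<otimes> x \<noteq> x \<otimes> k" using k mem_N_iff by blast
  then have "commutator x k \<noteq> \<one>" using k commutator_eq_one_iff [of x k] by (metis K.mem_carrier)
  then show "(\<lambda>g. commutator g k) ` carrier G \<noteq> {\<one>}" using x by blast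
qed

text \<open>For \<open>k\<close> in \<open>K\<close> outside \<open>N\<close>, the map
  \<open>commutator _ k\<close> has image \<open>N\<close> and kernel \<open>C\<close>.\<close>

lemma card_carrier: "card (carrier G) = p * card C"
proof -
  obtain k where k: "k \<in> K" "k \<notin> N" using ex_K_notin_N by blast
  have "{g \<in> carrier G. g \<otimes> k = k \<otimes> g} = C"
    unfolding C_def centralizer_def using commuting_with_K [OF k] k by blast
  then show ?thesis
    using card_commutator_image [OF fin subgroup_self, of k] commutator_image_carrier [OF k] k
    by (simp add: card_N)
qed

text \<open>Since \<open>C\<close> has prime index, \<open>C\<close> and any one element outside it
  generate \<open>G\<close>.\<close>

lemma C_maximal:
  assumes "subgroup T G" "C \<subseteq> T" "y \<in> T" "y \<notin> C"
  shows "T = carrier G"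
proof (rule subgroup_of_prime_index [OF subgroup_C assms(1) subgroup_self assms(2) _ _ fin card_carrier prime])
  show "T \<subseteq> carrier G" using assms(1) by (rule subgroup.subset)
  show "T \<noteq> C" using assms(3,4) by blast
qed

text \<open>Conjugation by \<open>g\<close> changes \<open>a\<close> and \<open>b\<close> only by
  left factors \<open>k\<close> and \<open>l\<close> from \<open>K\<close>. These commute with all
  of \<open>C\<close>, so they drop out of the commutator, which is therefore fixed by
  \<open>g\<close>.\<close>

lemma commutator_C_mem_N:
  assumes a: "a \<in> C" and b: "b \<in> C"
  shows "commutator a b \<in> N"
proof -
  have "commutator a b \<otimes> g = g \<otimes> commutator a b" if g: "g \<in> carrier G" for g
  proof -
    define k l where "k = commutator g a" and "l = commutator g b"
    have kl: "k \<in> K" "l \<in> K" using a b g commutator_mem_K by (auto simp: k_def l_def)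
    have conj: "g \<otimes> a \<otimes> inv g = k \<otimes> a" "g \<otimes> b \<otimes> inv g = l \<otimes> b"
      using a b g by (simp_all add: k_def l_def commutator_def m_assoc)
    have laY: "l \<otimes> b \<in> C" using kl b K_subset_Y Y_subset_C by auto
    have kca: "k \<otimes> commutator a (l \<otimes> b) = commutator a (l \<otimes> b) \<otimes> k"
      using K_commute kl a b commutator_mem_K by simp
    have "g \<otimes> commutator a b \<otimes> inv g = commutator (k \<otimes> a) (l \<otimes> b)"
      using a b g conj by (simp add: commutator_conj)
    also have "\<dots> = commutator a (l \<otimes> b) \<otimes> commutator k (l \<otimes> b)"
      using kl a b kca by (intro commutator_mult_left_of_commute) auto
    also have "commutator k (l \<otimes> b) = \<one>"
      using C_commutes [OF laY kl(1)] kl b commutator_eq_one_iff [of k "l \<otimes> b"] by simp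
    \<comment> \<open>Inversion swaps the arguments, so the product rule for the left argument also
      removes \<open>l\<close> on the right.\<close>
    also have "commutator a (l \<otimes> b) = inv (commutator (l \<otimes> b) a)"
      using a b kl by (simp add: inv_commutator)
    also have "commutator (l \<otimes> b) a = commutator b a \<otimes> commutator l a"
      using K_commute kl a b commutator_mem_K by (intro commutator_mult_left_of_commute) auto
    also have "commutator l a = \<one>"
      using C_commutes [OF a kl(2)] kl a commutator_eq_one_iff [of l a] by simp
    finally have "g \<otimes> commutator a b \<otimes> inv g = commutator a b"
      using a b by (simp add: inv_commutator)
    then have "commutator a b \<otimes> g = g \<otimes> commutator a b \<otimes> inv g \<otimes> g" by simp
    then show ?thesis using a b g by (simp add: m_assoc)
  qed
  then show ?thesis using mem_N_iff commutator_mem_K a b by simp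
qed

section \<open>Commuting modulo \<open>N\<close>\<close>

text \<open>This is the preimage of the centralizer of the coset of \<open>x\<close> in
  \<open>G / N\<close>; centrality of \<open>N\<close> makes the product rule applicable.\<close>

lemma subgroup_commuting_mod_N:
  assumes x: "x \<in> carrier G"
  shows "subgroup {g \<in> carrier G. commutator g x \<in> N} G"
proof (rule subgroupI)
  show "{g \<in> carrier G. commutator g x \<in> N} \<subseteq> carrier G" by auto
  have "commutator \<one> x = \<one>" using x by (simp add: commutator_eq_one_iff)
  then have "\<one> \<in> {g \<in> carrier G. commutator g x \<in> N}" by simp
  then show "{g \<in> carrier G. commutator g x \<in> N} \<noteq> {}" by blast
next
  fix g assume "g \<in> {g \<in> carrier G. commutator g x \<in> N}"
  then have g: "g \<in> carrier G" "commutator g x \<in> N" by auto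
  have "commutator (inv g \<otimes> g) x = commutator g x \<otimes> commutator (inv g) x"
    using g x N_central [OF g(2), of "inv g"] by (intro commutator_mult_left_of_commute) auto
  moreover have "commutator (inv g \<otimes> g) x = \<one>" using g x by (simp add: commutator_eq_one_iff)
  ultimately have "commutator g x \<otimes> commutator (inv g) x = \<one>" by simp
  then have "inv (commutator (inv g) x) = commutator g x" using g x by (intro inv_equality) auto
  then have "commutator (inv g) x = inv (commutator g x)" using g x by (metis commutator_closed inv_closed inv_inv)
  then show "inv g \<in> {g \<in> carrier G. commutator g x \<in> N}" using g by simp
next
  fix g h assume "g \<in> {g \<in> carrier G. commutator g x \<in> N}" "h \<in> {g \<in> carrier G. commutator g x \<in> N}"
  then have g: "g \<in> carrier G" "commutator g x \<in> N" and h: "h \<in> carrier G" "commutator h x \<in> N" by auto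
  have "commutator (g \<otimes> h) x = commutator h x \<otimes> commutator g x"
    using g h x N_central [OF h(2), of g] by (intro commutator_mult_left_of_commute) auto
  then show "g \<otimes> h \<in> {g \<in> carrier G. commutator g x \<in> N}" using g h by simp
qed

lemma commutator_mem_N_sym:
  assumes "x \<in> carrier G" "y \<in> carrier G" "commutator x y \<in> N"
  shows "commutator y x \<in> N"
  using N.m_inv_closed [OF assms(3)] inv_commutator [OF assms(1,2)] by simp

text \<open>By \<open>C_maximal\<close>, commuting with \<open>x\<close> modulo \<open>N\<close>
  need only be checked on \<open>C\<close> and on one \<open>y\<close> outside
  \<open>C\<close>.\<close>

lemma commuting_mod_N_of_C:
  assumes y: "y \<in> carrier G" "y \<notin> C" and c: "\<And>c. c \<in> C \<Longrightarrow> commutator c x \<in> N"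
    and x: "x \<in> carrier G" "commutator y x \<in> N" and g: "g \<in> carrier G"
  shows "commutator g x \<in> N"
proof -
  have "{g \<in> carrier G. commutator g x \<in> N} = carrier G"
    using c x y by (intro C_maximal [OF subgroup_commuting_mod_N [OF x(1)], of y]) auto
  then show ?thesis using g by blast
qed

text \<open>Otherwise \<open>y\<close> commutes modulo \<open>N\<close> with \<open>C\<close>, and
  \<open>C\<close> is abelian modulo \<open>N\<close>; as \<open>C\<close> and \<open>y\<close>
  generate \<open>G\<close>, all of \<open>G / N\<close> would be abelian, against
  \<open>ex_commutator_notin_N\<close>.\<close>

lemma ex_commutator_C_notin_N:
  assumes y: "y \<in> carrier G" "y \<notin> C"
  shows "\<exists>c\<in>C. commutator c y \<notin> N"
proof (rule ccontr)
  assume "\<not> ?thesis"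
  then have Cy: "commutator c y \<in> N" if "c \<in> C" for c using that by blast
  have Gy: "commutator g y \<in> N" if "g \<in> carrier G" for g
    using commuting_mod_N_of_C [OF y Cy y(1) _ that] y commutator_eq_one_iff [of y y] by simp
  have CG: "commutator g c \<in> N" if "c \<in> C" "g \<in> carrier G" for c g
    using commuting_mod_N_of_C [OF y commutator_C_mem_N [OF _ that(1)] _ _ that(2)]
      commutator_mem_N_sym [OF _ y(1) Cy [OF that(1)]] that(1) by simp
  have "commutator g x \<in> N" if "g \<in> carrier G" "x \<in> carrier G" for g x
    using commuting_mod_N_of_C [OF y _ that(2) _ that(1)] commutator_mem_N_sym [OF _ _ CG] commutator_mem_N_sym [OF that(2) y(1) Gy] that
    by (simp add: y)
  then show False using ex_commutator_notin_N by blast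
qed

section \<open>Images of the commutator maps on \<open>K\<close>, \<open>Y\<close>, \<open>C\<close>
  and \<open>G\<close>\<close>

lemma subgroup_commutator_image_C:
  assumes "subgroup S G" "S \<subseteq> C" "y \<in> carrier G"
  shows "subgroup ((\<lambda>g. commutator g y) ` S) G"
proof (rule subgroup_commutator_image [OF assms(1,3)])
  fix g h assume "g \<in> S" "h \<in> S"
  then show "g \<otimes> commutator h y = commutator h y \<otimes> g"
    using assms(2,3) by (intro C_commutes commutator_mem_K) auto
qed

text \<open>The values lie in \<open>N\<close> by \<open>commutator_mem_N\<close>, and some value is
  nontrivial because \<open>y\<close> does not centralize \<open>K\<close>.\<close>

lemma commutator_image_K:
  assumes y: "y \<in> carrier G" "y \<notin> C"
  shows "(\<lambda>g. commutator g y) ` K = N"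
proof (rule subgroup_of_prime_order [OF _ subgroup_N _ prime_card_N])
  show "subgroup ((\<lambda>g. commutator g y) ` K) G"
    using K_subset_Y Y_subset_C y by (intro subgroup_commutator_image_C [OF subgroup_K]) auto
  show "(\<lambda>g. commutator g y) ` K \<subseteq> N"
    using y commutator_mem_N commutator_mem_N_sym by auto
  obtain k where k: "k \<in> K" "y \<otimes> k \<noteq> k \<otimes> y" using y unfolding C_def centralizer_def by blast
  then have "commutator k y \<noteq> \<one>" using y commutator_eq_one_iff [of k y] by (metis K.mem_carrier)
  then show "(\<lambda>g. commutator g y) ` K \<noteq> {\<one>}" using k by blast
qed

text \<open>Already \<open>K\<close>, a part of \<open>Y\<close>, has image \<open>N\<close>. Which
  alternative holds decides between the two orders of \<open>G / Z(G)\<close> in the non-abelian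
  case.\<close>

lemma commutator_image_Y:
  assumes y: "y \<in> carrier G" "y \<notin> C"
  shows "(\<lambda>g. commutator g y) ` Y \<in> {N, K}"
proof -
  have "N \<subseteq> (\<lambda>g. commutator g y) ` Y"
    using commutator_image_K [OF y] K_subset_Y by blast
  moreover have "(\<lambda>g. commutator g y) ` Y \<subseteq> K" using y commutator_mem_K by auto
  ultimately show ?thesis
    using subgroup_between_N_K subgroup_commutator_image_C [OF subgroup_Y Y_subset_C y(1)] by blast
qed

text \<open>The image contains \<open>N\<close>, the image of \<open>K\<close>, and exceeds it by
  \<open>ex_commutator_C_notin_N\<close>.\<close>

lemma commutator_image_C:
  assumes y: "y \<in> carrier G" "y \<notin> C"
  shows "(\<lambda>g. commutator g y) ` C = K"
proof (rule subgroup_between_N_K)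
  show "subgroup ((\<lambda>g. commutator g y) ` C) G"
    using y by (intro subgroup_commutator_image_C [OF subgroup_C]) auto
  show "N \<subseteq> (\<lambda>g. commutator g y) ` C"
    using commutator_image_K [OF y] K_subset_Y Y_subset_C by blast
  show "(\<lambda>g. commutator g y) ` C \<subseteq> K" using y commutator_mem_K by auto
  show "(\<lambda>g. commutator g y) ` C \<noteq> N" using ex_commutator_C_notin_N [OF y] by blast
qed

lemma commutator_image_G:
  assumes y: "y \<in> carrier G" "y \<notin> C"
  shows "(\<lambda>g. commutator g y) ` carrier G = K"
proof
  show "K \<subseteq> (\<lambda>g. commutator g y) ` carrier G"
    using commutator_image_C [OF y] C.subset by blast
  show "(\<lambda>g. commutator g y) ` carrier G \<subseteq> K" using y commutator_mem_K by auto
qed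

lemma commutator_image_C_N:
  assumes x: "x \<in> C" "x \<notin> Y"
  shows "(\<lambda>g. commutator g x) ` C = N"
proof (rule subgroup_of_prime_order [OF _ subgroup_N _ prime_card_N])
  show "subgroup ((\<lambda>g. commutator g x) ` C) G"
    using x by (intro subgroup_commutator_image_C [OF subgroup_C]) auto
  show "(\<lambda>g. commutator g x) ` C \<subseteq> N" using x commutator_C_mem_N by auto
  obtain c where c: "c \<in> C" "x \<otimes> c \<noteq> c \<otimes> x" using x unfolding Y_def by blast
  then have "commutator c x \<noteq> \<one>" using x commutator_eq_one_iff [of c x] by (metis C.mem_carrier)
  then show "(\<lambda>g. commutator g x) ` C \<noteq> {\<one>}" using c by blast
qed

section \<open>The center of \<open>G\<close> and the orders of centralizers\<close>

lemma ex_notin_C: "\<exists>y\<in>carrier G. y \<notin> C"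
proof -
  obtain k where k: "k \<in> K" "k \<notin> N" using ex_K_notin_N by blast
  then obtain x where "x \<in> carrier G" "k \<otimes> x \<noteq> x \<otimes> k" using mem_N_iff by blast
  then show ?thesis using k C_commutes [of x k] by auto
qed

text \<open>An element of \<open>Y\<close> commutes with \<open>C\<close>, so it is central once it
  also commutes with \<open>y\<close>. Thus the center is the kernel of
  \<open>commutator _ y\<close> on \<open>Y\<close>.\<close>

lemma center_eq:
  assumes y: "y \<in> carrier G" "y \<notin> C"
  shows "group_center G = {z \<in> Y. z \<otimes> y = y \<otimes> z}"
proof
  show "group_center G \<subseteq> {z \<in> Y. z \<otimes> y = y \<otimes> z}"
    unfolding group_center_def Y_def C_def centralizer_def using y K_carrier by blast
  show "{z \<in> Y. z \<otimes> y = y \<otimes> z} \<subseteq> group_center G"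
  proof
    fix z assume z: "z \<in> {z \<in> Y. z \<otimes> y = y \<otimes> z}"
    then have zc: "z \<in> carrier G" by simp
    have "{g \<in> carrier G. g \<otimes> z = z \<otimes> g} = carrier G"
    proof (rule C_maximal [OF subgroup_commuting [OF subgroup_self zc] _ _ y(2)])
      show "C \<subseteq> {g \<in> carrier G. g \<otimes> z = z \<otimes> g}"
        using z C.subset unfolding Y_def by (blast intro: sym)
      show "y \<in> {g \<in> carrier G. g \<otimes> z = z \<otimes> g}" using z y by (blast intro: sym)
    qed
    then show "z \<in> group_center G" unfolding group_center_def using zc by (blast intro: sym)
  qed
qed

lemma card_Y: "card Y \<in> {p * card (group_center G), p ^ 2 * card (group_center G)}"
proof -
  obtain y where y: "y \<in> carrier G" "y \<notin> C" using ex_notin_C by blast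
  show ?thesis
    using card_commutator_image [OF fin subgroup_Y y(1)] commutator_image_Y [OF y] center_eq [OF y]
      card_N card_K by auto
qed

lemma card_C_commuting:
  assumes y: "y \<in> carrier G" "y \<notin> C"
  shows "card C = p ^ 2 * card {g \<in> C. g \<otimes> y = y \<otimes> g}"
  using card_commutator_image [OF fin subgroup_C y(1)] commutator_image_C [OF y] card_K by simp

lemma card_G_commuting:
  assumes y: "y \<in> carrier G" "y \<notin> C"
  shows "card (carrier G) = p ^ 2 * card {g \<in> carrier G. g \<otimes> y = y \<otimes> g}"
  using card_commutator_image [OF fin subgroup_self y(1)] commutator_image_G [OF y] card_K by simp

lemma card_C_commuting_C:
  assumes x: "x \<in> C" "x \<notin> Y"
  shows "card C = p * card {g \<in> C. g \<otimes> x = x \<otimes> g}"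
  using card_commutator_image [OF fin subgroup_C, of x] commutator_image_C_N [OF x] card_N x by simp

lemma C_Y_even_power: "\<exists>s. card C = p ^ (2 * s) * card Y"
  unfolding Y_def card_N [symmetric]
  using N_subset_K
  by (intro card_central_quotient_even_power [OF fin subgroup_C subgroup_N prime_card_N]
      commutator_C_mem_N C_commutes) auto

section \<open>The common preimage of the centers of \<open>G / N\<close> and
  \<open>G / Z(G)\<close>\<close>

definition "M = {g \<in> carrier G. \<forall>x\<in>carrier G. commutator g x \<in> N}"

lemma M_subset_C: "M \<subseteq> C"
proof
  fix y assume y: "y \<in> M"
  show "y \<in> C"
  proof (rule ccontr)
    assume "y \<notin> C"
    then obtain c where c: "c \<in> C" "commutator c y \<notin> N"
      using y ex_commutator_C_notin_N by (auto simp: M_def)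
    then show False using y commutator_mem_N_sym [of y c] by (auto simp: M_def)
  qed
qed

text \<open>Elements of \<open>C\<close> already commute modulo \<open>N\<close> with
  \<open>C\<close>, so only the condition at \<open>y\<close> remains.\<close>

lemma M_eq:
  assumes y: "y \<in> carrier G" "y \<notin> C"
  shows "M = {c \<in> C. commutator c y \<in> N}"
proof
  show "M \<subseteq> {c \<in> C. commutator c y \<in> N}" using M_subset_C y by (auto simp: M_def)
  show "{c \<in> C. commutator c y \<in> N} \<subseteq> M"
  proof
    fix c assume "c \<in> {c \<in> C. commutator c y \<in> N}"
    then have c: "c \<in> C" "commutator c y \<in> N" by auto
    have "commutator g c \<in> N" if "g \<in> carrier G" for g
      using commuting_mod_N_of_C [OF y commutator_C_mem_N [OF _ c(1)] _ commutator_mem_N_sym [OF _ y(1) c(2)] that] c(1)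
      by simp
    then show "c \<in> M" using c commutator_mem_N_sym by (auto simp: M_def)
  qed
qed

lemma subgroup_M: "subgroup M G"
proof -
  obtain y where y: "y \<in> carrier G" "y \<notin> C" using ex_notin_C by blast
  have "M = C \<inter> {g \<in> carrier G. commutator g y \<in> N}" using M_eq [OF y] by auto
  then show ?thesis
    using subgroups_Inter_pair [OF subgroup_C subgroup_commuting_mod_N [OF y(1)]] by simp
qed

text \<open>On \<open>M\<close> and on \<open>C\<close> the map \<open>commutator _ y\<close> has
  the same kernel, while its images are \<open>N\<close> and \<open>K\<close>. So \<open>M\<close>
  has index \<open>p\<close> in \<open>C\<close>, and \<open>C\<close> has index \<open>p\<close> in
  \<open>G\<close>.\<close>

lemma card_carrier_M: "card (carrier G) = p ^ 2 * card M"
proof -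
  obtain y where y: "y \<in> carrier G" "y \<notin> C" using ex_notin_C by blast
  have "(\<lambda>g. commutator g y) ` M = N"
    using commutator_image_C [OF y] N_subset_K M_eq [OF y] by auto
  moreover have "{g \<in> M. g \<otimes> y = y \<otimes> g} = {g \<in> C. g \<otimes> y = y \<otimes> g}"
  proof -
    have "commutator g y \<in> N" if "g \<in> C" "g \<otimes> y = y \<otimes> g" for g
      using commutator_eq_one_iff [of g y] that y N.one_closed by (metis C.mem_carrier)
    then show ?thesis using M_eq [OF y] by blast
  qed
  ultimately have "card M = p * card {g \<in> C. g \<otimes> y = y \<otimes> g}"
    using card_commutator_image [OF fin subgroup_M y(1)] card_N by simp
  then show ?thesis
    using card_C_commuting [OF y] card_carrier by (simp add: power2_eq_square)
qed

section \<open>Counting commuting pairs\<close>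

lemma card_pos: "subgroup H G \<Longrightarrow> card H > 0"
  using finite_subgroup subgroup.one_closed card_gt_0_iff by blast

text \<open>An element outside \<open>C\<close> has centralizers of index \<open>p ^ 2\<close> both
  in \<open>G\<close> and in \<open>C\<close>; one of \<open>C - Y\<close> has a centralizer of
  index \<open>p\<close> in \<open>C\<close>; one of \<open>Y\<close> commutes with all of
  \<open>C\<close>.\<close>

lemma comm_degree_eq:
  "comm_degree G = (real p ^ 2 + real p - 1) / real p ^ 4 + (real p - 1) / real p ^ 3 * (card Y / card C)"
proof -
  \<comment> \<open>\<open>cp S T\<close> is the number of commuting pairs in
    \<open>S \<times> T\<close>, written as a sum of centralizer orders so that the first factor can
    be split.\<close>
  define cp where "cp S T = (\<Sum>x\<in>S. real (card {y \<in> T. y \<otimes> x = x \<otimes> y}))" for S T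
  let ?G = "carrier G" and ?D = "carrier G - C"
  have finC: "finite C" "finite Y" using finite_subgroup subgroup_C subgroup_Y by auto
  have p0: "real p > 0" using p_gt_1 by simp
  have c0: "real (card C) > 0" using card_pos [OF subgroup_C] by simp
  have cG: "real (card ?G) = real p * real (card C)" using card_carrier by simp
  have pairs: "real (card {(x, y). x \<in> S \<and> y \<in> T \<and> x \<otimes> y = y \<otimes> x}) = cp S T"
    if "finite S" "finite T" for S T
  proof -
    have "{(x, y). x \<in> S \<and> y \<in> T \<and> x \<otimes> y = y \<otimes> x} = (SIGMA x:S. {y \<in> T. y \<otimes> x = x \<otimes> y})"
      by (auto intro: sym)
    then show ?thesis using that by (simp add: cp_def)
  qed
  have swap: "cp S T = cp T S" if "finite S" "finite T" for S T
  proof -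
    have "{(x, y). x \<in> S \<and> y \<in> T \<and> x \<otimes> y = y \<otimes> x} = prod.swap ` {(x, y). x \<in> T \<and> y \<in> S \<and> x \<otimes> y = y \<otimes> x}"
      by force
    then have "card {(x, y). x \<in> S \<and> y \<in> T \<and> x \<otimes> y = y \<otimes> x} = card {(x, y). x \<in> T \<and> y \<in> S \<and> x \<otimes> y = y \<otimes> x}"
      by (simp add: card_image)
    then show ?thesis using pairs [of S T] pairs [of T S] that by simp
  qed
  have split: "cp S T = cp (S - R) T + cp R T" if "finite S" "R \<subseteq> S" for S T R
    unfolding cp_def using that by (rule sum.subset_diff [rotated])
  have const: "cp S T = real (card S) * v" if "\<And>x. x \<in> S \<Longrightarrow> real (card {y \<in> T. y \<otimes> x = x \<otimes> y}) = v" for S T v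
    unfolding cp_def using that by simp
  have cardD: "real (card ?D) = real p * card C - card C"
    using finC C.subset card_mono [OF fin C.subset] cG by (simp add: card_Diff_subset of_nat_diff)
  have cardCY: "real (card (C - Y)) = real (card C) - card Y"
    using finC Y_subset_C card_mono [OF finC(1) Y_subset_C] by (simp add: card_Diff_subset of_nat_diff)
  have DG: "cp ?D ?G = real (card ?D) * (real p * card C / real p ^ 2)"
  proof (rule const)
    fix x assume "x \<in> ?D"
    then have "card ?G = p ^ 2 * card {y \<in> ?G. y \<otimes> x = x \<otimes> y}" using card_G_commuting by blast
    then have "real (card ?G) = real p ^ 2 * card {y \<in> ?G. y \<otimes> x = x \<otimes> y}" by simp
    then show "real (card {y \<in> ?G. y \<otimes> x = x \<otimes> y}) = real p * card C / real p ^ 2"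
      using p0 cG by (simp add: field_simps)
  qed
  have DC: "cp ?D C = real (card ?D) * (card C / real p ^ 2)"
  proof (rule const)
    fix x assume "x \<in> ?D"
    then have "card C = p ^ 2 * card {y \<in> C. y \<otimes> x = x \<otimes> y}" using card_C_commuting by blast
    then have "real (card C) = real p ^ 2 * card {y \<in> C. y \<otimes> x = x \<otimes> y}" by (metis of_nat_mult of_nat_power)
    then show "real (card {y \<in> C. y \<otimes> x = x \<otimes> y}) = card C / real p ^ 2"
      using p0 by (simp add: field_simps)
  qed
  have CYC: "cp (C - Y) C = real (card (C - Y)) * (card C / real p)"
  proof (rule const)
    fix x assume "x \<in> C - Y"
    then have "card C = p * card {y \<in> C. y \<otimes> x = x \<otimes> y}" using card_C_commuting_C by blast
    then have "real (card C) = real p * card {y \<in> C. y \<otimes> x = x \<otimes> y}" by (metis of_nat_mult)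
    then show "real (card {y \<in> C. y \<otimes> x = x \<otimes> y}) = card C / real p"
      using p0 by (simp add: field_simps)
  qed
  have YC: "cp Y C = real (card Y) * card C"
  proof (rule const)
    fix x assume "x \<in> Y"
    then have "{y \<in> C. y \<otimes> x = x \<otimes> y} = C" unfolding Y_def by (blast intro: sym)
    then show "real (card {y \<in> C. y \<otimes> x = x \<otimes> y}) = card C" by simp
  qed
  \<comment> \<open>Pairs in \<open>C \<times> G\<close> are swapped, so that the factor
    \<open>G\<close> comes first and can again be split into \<open>?D\<close> and
    \<open>C\<close>.\<close>
  have "cp ?G ?G = cp ?D ?G + cp C ?G" using split [OF fin C.subset] .
  also have "cp C ?G = cp ?D C + cp C C"
    using swap [OF finC(1) fin] split [OF fin C.subset] by simp
  also have "cp C C = cp (C - Y) C + cp Y C" using split [OF finC(1) Y_subset_C] .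
  finally have total: "cp ?G ?G = (real p * card C - card C) * (real p * card C / real p ^ 2)
      + ((real p * card C - card C) * (card C / real p ^ 2)
      + ((real (card C) - card Y) * (card C / real p) + real (card Y) * card C))"
    unfolding DG DC CYC YC cardD cardCY .
  have "comm_degree G = cp ?G ?G / (real p * card C) ^ 2"
    unfolding comm_degree_def pairs [OF fin fin] cG ..
  also have "\<dots> = (real p ^ 2 + real p - 1) / real p ^ 4 + (real p - 1) / real p ^ 3 * (card Y / card C)"
    unfolding total using p0 c0 by (simp add: field_simps power_numeral_reduce)
  finally show ?thesis .
qed

section \<open>Orders of the quotients and the two cases\<close>

lemma group_center_C: "group_center (G\<lparr>carrier := C\<rparr>) = Y"
  by (simp add: group_center_def Y_def)

lemma card_C_Mod: "card (carrier (G\<lparr>carrier := C\<rparr> Mod group_center (G\<lparr>carrier := C\<rparr>))) * card Y = card C"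
proof -
  interpret CG: group "G\<lparr>carrier := C\<rparr>" using subgroup_C by (rule subgroup_imp_group)
  show ?thesis
    using CG.card_carrier_Mod [OF CG.subgroup_group_center] by (simp add: group_center_C)
qed

lemma card_G_Mod_center: "card (carrier (G Mod group_center G)) * card (group_center G) = card (carrier G)"
  by (rule card_carrier_Mod [OF subgroup_group_center])

lemma card_Gbar: "card (carrier ((G Mod N) Mod group_center (G Mod N))) = p ^ 2"
proof -
  have "N \<lhd> G" using subgroup_N by (rule central_subgroup_normal) (auto simp: N_def)
  then have "card (carrier ((G Mod N) Mod group_center (G Mod N))) * card M = card (carrier G)"
    by (rule card_Mod_center_Mod [OF _ subgroup_M M_def])
  then show ?thesis using card_pos [OF subgroup_M] by (simp add: card_carrier_M)
qed

lemma card_Ghat: "card (carrier ((G Mod group_center G) Mod group_center (G Mod group_center G))) = p ^ 2"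
proof -
  \<comment> \<open>All commutators lie in \<open>K\<close>, so lying in the center is the same for
    them as lying in \<open>N\<close>.\<close>
  have "M = {g \<in> carrier G. \<forall>x\<in>carrier G. commutator g x \<in> group_center G}"
    unfolding M_def N_def using commutator_mem_K by blast
  then have "card (carrier ((G Mod group_center G) Mod group_center (G Mod group_center G))) * card M = card (carrier G)"
    by (intro card_Mod_center_Mod [OF _ subgroup_M] central_subgroup_normal subgroup_group_center) auto
  then show ?thesis using card_pos [OF subgroup_M] by (simp add: card_carrier_M)
qed

lemma C_eq_Y_iff: "C = Y \<longleftrightarrow> abelian_set G C"
  unfolding Y_def abelian_set_def by blast

lemma abelian_case:
  assumes "abelian_set G C"
  shows "comm_degree G = (2 * real p ^ 2 - 1) / real p ^ 4" "card (carrier (G Mod group_center G)) = p ^ 3"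
proof -
  have CY: "C = Y" using assms C_eq_Y_iff by blast
  have "real (card Y) / card C = 1" using CY card_pos [OF subgroup_C] by simp
  then show "comm_degree G = (2 * real p ^ 2 - 1) / real p ^ 4"
    using comm_degree_eq p_gt_1 by (simp add: field_simps power_numeral_reduce)
  obtain y where y: "y \<in> carrier G" "y \<notin> C" using ex_notin_C by blast
  \<comment> \<open>With \<open>C = Y\<close>, the kernel of \<open>commutator _ y\<close> on
    \<open>C\<close> is the center of \<open>G\<close>.\<close>
  have "card C = p ^ 2 * card (group_center G)"
    using card_C_commuting [OF y] center_eq [OF y] CY by simp
  then have "card (carrier (G Mod group_center G)) * card (group_center G) = p ^ 3 * card (group_center G)"
    using card_G_Mod_center card_carrier by (simp add: power2_eq_square power3_eq_cube mult.assoc)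
  then show "card (carrier (G Mod group_center G)) = p ^ 3"
    using card_pos [OF subgroup_group_center] by simp
qed

lemma nonabelian_case:
  assumes "\<not> abelian_set G C"
  shows "\<exists>s>0. card (carrier (G\<lparr>carrier := C\<rparr> Mod group_center (G\<lparr>carrier := C\<rparr>))) = p ^ (2 * s)
    \<and> comm_degree G = (1 / real p ^ 4) * ((real p - 1) / real p ^ (2 * s - 1) + real p ^ 2 + real p - 1)
    \<and> card (carrier (G Mod group_center G)) \<in> {p ^ (2 * s + 2), p ^ (2 * s + 3)}"
proof -
  obtain s where s: "card C = p ^ (2 * s) * card Y" using C_Y_even_power by blast
  have Y0: "card Y > 0" using card_pos [OF subgroup_Y] .
  have "s \<noteq> 0"
  proof
    assume "s = 0"
    then have "C = Y" using s card_subset_eq [OF finite_subgroup [OF subgroup_C] Y_subset_C] by simp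
    then show False using assms C_eq_Y_iff by blast
  qed
  \<comment> \<open>Because \<open>s\<close> is nonzero the subtraction on \<open>nat\<close> is
    exact, and one factor \<open>p\<close> splits off to leave the exponent
    \<open>2 * s - 1\<close>.\<close>
  then have "2 * s = Suc (2 * s - 1)" by simp
  then have ps: "real p ^ (2 * s) = real p * real p ^ (2 * s - 1)" by (metis power_Suc)
  define q where "q = real p ^ (2 * s - 1)"
  have q: "q > 0" "real p > 0" using p_gt_1 by (simp_all add: q_def)
  have YC: "real (card Y) / card C = 1 / (real p * q)"
    using Y0 by (simp add: s ps q_def)
  have "comm_degree G = (1 / real p ^ 4) * ((real p - 1) / q + real p ^ 2 + real p - 1)"
    unfolding comm_degree_eq YC using q by (simp add: field_simps power_numeral_reduce)
  then have deg: "comm_degree G = (1 / real p ^ 4) * ((real p - 1) / real p ^ (2 * s - 1) + real p ^ 2 + real p - 1)"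
    unfolding q_def .
  have card1: "card (carrier (G\<lparr>carrier := C\<rparr> Mod group_center (G\<lparr>carrier := C\<rparr>))) = p ^ (2 * s)"
    using card_C_Mod Y0 unfolding s by simp
  let ?z = "card (group_center G)"
  have z: "?z > 0" using card_pos [OF subgroup_group_center] .
  have card_hat: "card (carrier (G Mod group_center G)) * ?z = p * (p ^ (2 * s) * card Y)"
    unfolding card_G_Mod_center card_carrier s ..
  \<comment> \<open>The exponent of \<open>p\<close> collects 1 from \<open>G\<close> over
    \<open>C\<close>, \<open>2 * s\<close> from \<open>C\<close> over \<open>Y\<close>, and 1 or 2
    from \<open>Y\<close> over the center.\<close>
  have "card Y = p * ?z \<or> card Y = p ^ 2 * ?z" using card_Y by blast
  then have "card (carrier (G Mod group_center G)) = p ^ (2 * s + 2) \<or>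
      card (carrier (G Mod group_center G)) = p ^ (2 * s + 3)"
  proof
    assume "card Y = p * ?z"
    then have "card (carrier (G Mod group_center G)) * ?z = p ^ (2 * s + 2) * ?z"
      unfolding card_hat by (simp add: power_add power2_eq_square)
    then show ?thesis using z by (metis mult_right_cancel less_numeral_extra(3))
  next
    assume "card Y = p ^ 2 * ?z"
    then have "card (carrier (G Mod group_center G)) * ?z = p ^ (2 * s + 3) * ?z"
      unfolding card_hat by (simp add: power_add power2_eq_square power3_eq_cube)
    then show ?thesis using z by (metis mult_right_cancel less_numeral_extra(3))
  qed
  then have "card (carrier (G Mod group_center G)) \<in> {p ^ (2 * s + 2), p ^ (2 * s + 3)}" by blast
  then show ?thesis using deg card1 \<open>s \<noteq> 0\<close> by blast
qed

end

theorem theorem3p5: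
  fixes G (structure) and p :: nat
  assumes "group G" and "finite (carrier G)" and "Factorial_Ring.prime p"
    and "gcd (p - 1) (order G) = 1"
    and "card (commutator_subgroup G) = p ^ 2"
    and "card (commutator_subgroup G \<inter> group_center G) = p"
  shows
    "let C = centralizer G (commutator_subgroup G);
         CG = G\<lparr>carrier := C\<rparr>;
         N = commutator_subgroup G \<inter> group_center G;
         Gbar = G Mod N;
         Ghat = G Mod (group_center G)
     in (abelian_set G C \<longrightarrow>
            comm_degree G = (2 * real p ^ 2 - 1) / real p ^ 4
          \<and> card (carrier Ghat) = p ^ 3)
      \<and> (\<not> abelian_set G C \<longrightarrow>
            (\<exists>s::nat. s > 0 \<and> card (carrier (CG Mod (group_center CG))) = p ^ (2 * s)
              \<and> comm_degree G = (1 / real p ^ 4) *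
                   ((real p - 1) / real p ^ (2 * s - 1) + real p ^ 2 + real p - 1)
              \<and> card (carrier Ghat) \<in> {p ^ (2 * s + 2), p ^ (2 * s + 3)}))
      \<and> card (carrier (Gbar Mod (group_center Gbar))) = p ^ 2
      \<and> card (carrier (Ghat Mod (group_center Ghat))) = p ^ 2"
proof -
  interpret derived_subgroup_order_p2 G p
    by (intro derived_subgroup_order_p2.intro derived_subgroup_order_p2_axioms.intro assms)
  show ?thesis
    using abelian_case nonabelian_case card_Gbar card_Ghat
    unfolding Let_def C_def N_def K_def by blast
qed

end
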